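(* Let $(S,\dot\nabla,e)$ be the dagger Frobenius structure associated with a coherent configuration. Then the data $(S,\dot\nabla,e)$ uniquely determine the structure constants $\nabla$ of the coherent configuration. That is: if $(X,S)$ and $(X',S')$ are coherent configurations with structure constants $\nabla,\nabla'$ and associated dagger Frobenius structures $(S,\dot\nabla,e)$, $(S',\dot\nabla',e')$, and $\theta\colon S\to S'$ is a bijection with $(\dot\nabla')_{\theta(a)\theta(b)}^{\theta(c)}=\dot\nabla_{ab}^c$ and $(e')_*^{\theta(a)}=e_*^a$ for all $a,b,c\in S$, then $(\nabla')_{\theta(a)\theta(b)}^{\theta(c)}=\nabla_{ab}^c$ for all $a,b,c\in S$.
   Context: A coherent configuration $(X,S)$ is a finite set $X$ with a partition $S$ of $X\times X$ such that: if $p\in S$ contains some $(x,x)$ then $p\subseteq\mathrm{id}_X$; for $a,b,c\in S$ the number $\nabla_{ab}^c$ (structure constant) of $z\in X$ with $(x,z)\in a$, $(z,y)\in b$ is the same for all $(x,y)\in c$; and $c\in S$ implies $c^{-1}=\{(y,x):(x,y)\in c\}\in S$. The valency $\|a\|$ of $a\in S$ is the number of $y\in X$ with $(x,y)\in a$, for any $x$ for which at least one such $y$ exists (independent of $x$). The dagger Frobenius structure associated with $(X,S)$ is $(S,\dot\nabla,e)$, where $\dot\nabla_{ab}^c=\sqrt{\frac{\|c\|}{\|a\|\|b\|}}\,\nabla_{ab}^c$ and $e_*^a=1$ if $a\subseteq\mathrm{id}_X$, $e_*^a=0$ otherwise. *)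

theory Defs
  imports Complex_Main "HOL-Library.Disjoint_Sets"
begin

definition coherent_configuration :: "'a set \<Rightarrow> ('a \<times> 'a) set set \<Rightarrow> bool" where
  "coherent_configuration X S \<longleftrightarrow>
     finite X \<and>
     partition_on (X \<times> X) S \<and>
     (\<forall>p\<in>S. (\<exists>x. (x, x) \<in> p) \<longrightarrow> p \<subseteq> Id_on X) \<and>
     (\<forall>a\<in>S. \<forall>b\<in>S. \<forall>c\<in>S. \<exists>n. \<forall>(x, y)\<in>c.
        card {z \<in> X. (x, z) \<in> a \<and> (z, y) \<in> b} = n) \<and>
     (\<forall>c\<in>S. c\<inverse> \<in> S)"

text \<open>The common value in the third axiom, \<open>\<nabla>\<^sub>a\<^sub>b\<^sup>c\<close>. It is only meaningful for \<open>a, b, c \<in> S\<close>,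
  where it is well defined since \<open>c\<close> is nonempty (\<open>structure_constant_eq\<close> below).\<close>

definition structure_constant ::
    "'a set \<Rightarrow> ('a \<times> 'a) set \<Rightarrow> ('a \<times> 'a) set \<Rightarrow> ('a \<times> 'a) set \<Rightarrow> nat" where
  "structure_constant X a b c =
     (THE n. \<forall>(x, y)\<in>c. card {z \<in> X. (x, z) \<in> a \<and> (z, y) \<in> b} = n)"

text \<open>The quantifier ranges over the points with at least one outgoing \<open>a\<close>-edge only; see
  \<open>valency_eq\<close> for the independence of the choice of such a point.\<close>

definition valency :: "'a set \<Rightarrow> ('a \<times> 'a) set \<Rightarrow> nat" where
  "valency X a = (THE n. \<forall>x\<in>Domain a. card {y \<in> X. (x, y) \<in> a} = n)"

definition dagger_mult ::
    "'a set \<Rightarrow> ('a \<times> 'a) set \<Rightarrow> ('a \<times> 'a) set \<Rightarrow> ('a \<times> 'a) set \<Rightarrow> real" where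
  "dagger_mult X a b c =
     sqrt (real (valency X c) / (real (valency X a) * real (valency X b)))
       * real (structure_constant X a b c)"

definition dagger_unit :: "'a set \<Rightarrow> ('a \<times> 'a) set \<Rightarrow> real" where
  "dagger_unit X a = (if a \<subseteq> Id_on X then 1 else 0)"

lemma structure_constant_eq:
  assumes "coherent_configuration X S" "a \<in> S" "b \<in> S" "c \<in> S" "(x, y) \<in> c"
  shows "structure_constant X a b c = card {z \<in> X. (x, z) \<in> a \<and> (z, y) \<in> b}"
proof -
  let ?P = "\<lambda>n. \<forall>(x, y)\<in>c. card {z \<in> X. (x, z) \<in> a \<and> (z, y) \<in> b} = n"
  have all: "\<forall>a\<in>S. \<forall>b\<in>S. \<forall>c\<in>S. \<exists>n. \<forall>(x, y)\<in>c.
      card {z \<in> X. (x, z) \<in> a \<and> (z, y) \<in> b} = n"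
    using assms(1) unfolding coherent_configuration_def by (elim conjE)
  obtain n where n: "?P n"
    using bspec[OF bspec[OF bspec[OF all assms(2)] assms(3)] assms(4)] ..
  have eq: "card {z \<in> X. (x, z) \<in> a \<and> (z, y) \<in> b} = m" if "?P m" for m
    using bspec[OF that assms(5)] by simp
  have "(THE n. ?P n) = n"
  proof (rule the_equality[of ?P, OF n])
    show "m = n" if "?P m" for m
      using eq[OF that] eq[OF n] by (rule trans[OF sym])
  qed
  then show ?thesis
    unfolding structure_constant_def eq[OF n] .
qed

lemma valency_eq:
  assumes cc: "coherent_configuration X S" and a: "a \<in> S" and xy: "(x, y) \<in> a"
  shows "valency X a = card {y \<in> X. (x, y) \<in> a}"
proof -
  have part: "partition_on (X \<times> X) S"
    and diag: "\<And>p u. p \<in> S \<Longrightarrow> (u, u) \<in> p \<Longrightarrow> p \<subseteq> Id_on X"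
    and conv: "a\<inverse> \<in> S"
    using cc a unfolding coherent_configuration_def by simp_all blast
  have sub: "a \<subseteq> X \<times> X"
    using partition_onD1[OF part] a by auto
  obtain p where p: "p \<in> S" "(x, x) \<in> p"
    using partition_onD1[OF part] xy sub by blast
  have fin: "finite X" using cc unfolding coherent_configuration_def by simp
  have "x \<in> {z \<in> X. (x, z) \<in> p \<and> (z, y) \<in> a}"
    using p xy sub by auto
  then have pos: "structure_constant X p a a > 0"
    using structure_constant_eq[OF cc p(1) a a xy] fin by (auto simp: card_gt_0_iff)
  have eq: "card {y \<in> X. (x', y) \<in> a} = card {y \<in> X. (x, y) \<in> a}" if "(x', y') \<in> a" for x' y'
  proof -
    have "card {z \<in> X. (x', z) \<in> p \<and> (z, y') \<in> a} > 0"
      using structure_constant_eq[OF cc p(1) a a that] pos by simp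
    then obtain z where "(x', z) \<in> p" by (auto simp: card_gt_0_iff)
    then have "(x', x') \<in> p" using diag[OF p] by auto
    then show ?thesis
      using structure_constant_eq[OF cc a conv p(1), of x' x']
        structure_constant_eq[OF cc a conv p] by simp
  qed
  show ?thesis
    unfolding valency_def
  proof (rule the_equality)
    show "\<forall>u\<in>Domain a. card {y \<in> X. (u, y) \<in> a} = card {y \<in> X. (x, y) \<in> a}"
      using eq by blast
  next
    fix m
    assume "\<forall>u\<in>Domain a. card {y \<in> X. (u, y) \<in> a} = m"
    then show "m = card {y \<in> X. (x, y) \<in> a}"
      using DomainI[OF xy] by simp
  qed
qed

end

(* The numbers v a = sqrt (valency a) satisfy v a * v a\<inverse> = (\<Sum>c. dagger_mult a a\<inverse> c * v c), and
   if d is the part of the diagonal that carries the source of a, then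
   dagger_mult a b d is nonzero only for b = a\<inverse>, where it equals v a / v a\<inverse>. So \<theta> commutes with
   converse, and r a = v' (\<theta> a) / v a satisfies r a\<inverse> = r a. Hence (r a)^2 is a weighted mean of the
   r c; for a maximizing r this gives (r a)^2 \<le> r a, so r \<le> 1 everywhere. Applied to the inverse
   of \<theta> as well, this gives r = 1: the valencies agree, and thus the structure constants too. *)

theory Submission imports Defs begin

lemma partition_on_eqI:
  assumes "partition_on A P" "p \<in> P" "q \<in> P" "x \<in> p" "x \<in> q"
  shows "p = q"
  using partition_onD2[OF assms(1)] assms(2-) by (auto dest: disjointD)

lemma dagger_mult_nonneg: "dagger_mult X a b c \<ge> 0"
  unfolding dagger_mult_def by simp

section \<open>Counting in a single coherent configuration\<close>

context
  fixes X :: "'a set" and S :: "('a \<times> 'a) set set"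
  assumes cc: "coherent_configuration X S"
begin

lemma cc_partition: "partition_on (X \<times> X) S"
  using cc unfolding coherent_configuration_def by simp

lemma cc_finite_points: "finite X"
  using cc unfolding coherent_configuration_def by simp

lemma cc_finite: "finite S"
  using finite_elements[OF _ cc_partition] cc_finite_points by simp

lemma cc_subset: "a \<in> S \<Longrightarrow> a \<subseteq> X \<times> X"
  using partition_onD1[OF cc_partition] by auto

lemma cc_nonempty: "a \<in> S \<Longrightarrow> \<exists>x y. (x, y) \<in> a"
  using partition_onD3[OF cc_partition] by (metis ex_in_conv surj_pair)

lemma cc_converse: "a \<in> S \<Longrightarrow> a\<inverse> \<in> S"
  using cc unfolding coherent_configuration_def by simp

lemma cc_diagonal: "p \<in> S \<Longrightarrow> (x, x) \<in> p \<Longrightarrow> p \<subseteq> Id_on X"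
  using cc unfolding coherent_configuration_def by blast

lemma cc_cover: "x \<in> X \<Longrightarrow> y \<in> X \<Longrightarrow> \<exists>p\<in>S. (x, y) \<in> p"
  using partition_onD1[OF cc_partition] by blast

text \<open>The left-hand side does not mention \<open>(x, y)\<close>. Hence a path along
  \<open>a\<close> and then \<open>b\<close> over one edge of \<open>c\<close> yields such a path
  over every edge of \<open>c\<close>; the lemmas below move local information from point to point
  this way.\<close>

lemma structure_constant_pos_iff:
  assumes "a \<in> S" "b \<in> S" "c \<in> S" "(x, y) \<in> c"
  shows "structure_constant X a b c > 0 \<longleftrightarrow> (\<exists>z. (x, z) \<in> a \<and> (z, y) \<in> b)"
  using structure_constant_eq[OF cc assms] cc_finite_points cc_subset[OF assms(1)]
  by (auto simp: card_gt_0_iff)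

lemma valency_pos:
  assumes "a \<in> S"
  shows "valency X a > 0"
proof -
  obtain x y where xy: "(x, y) \<in> a"
    using cc_nonempty[OF assms] by blast
  then have "y \<in> {y \<in> X. (x, y) \<in> a}"
    using cc_subset[OF assms] by auto
  then show ?thesis
    using valency_eq[OF cc assms xy] cc_finite_points by (auto simp: card_gt_0_iff)
qed

text \<open>Let \<open>p\<close> be the diagonal class at the common source \<open>x\<close>. The
  trivial path \<open>p\<close>, \<open>c\<close> over an edge of \<open>c\<close> at
  \<open>x\<close> transfers to every edge of \<open>c\<close>, so all sources of \<open>c\<close>
  lie on \<open>p\<close>. The closed path \<open>a\<close>, \<open>a\<inverse>\<close> at
  \<open>x\<close> then transfers along \<open>p\<close> to each of them.\<close>

lemma Domain_subset_if_meet: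
  assumes a: "a \<in> S" and c: "c \<in> S" and x: "x \<in> Domain a" "x \<in> Domain c"
  shows "Domain c \<subseteq> Domain a"
proof
  fix u assume "u \<in> Domain c"
  then obtain v where uv: "(u, v) \<in> c" by blast
  obtain y where xy: "(x, y) \<in> a" using x by blast
  obtain w where xw: "(x, w) \<in> c" using x by blast
  obtain p where p: "p \<in> S" "(x, x) \<in> p"
    using cc_cover xy cc_subset[OF a] by blast
  have "structure_constant X p c c > 0"
    using structure_constant_pos_iff[OF p(1) c c xw] p xw by blast
  then obtain z where "(u, z) \<in> p"
    using structure_constant_pos_iff[OF p(1) c c uv] by blast
  then have u: "(u, u) \<in> p" using cc_diagonal[OF p] by auto
  have "structure_constant X a (a\<inverse>) p > 0"
    using structure_constant_pos_iff[OF a cc_converse[OF a] p] xy by blast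
  then show "u \<in> Domain a"
    using structure_constant_pos_iff[OF a cc_converse[OF a] p(1) u] by blast
qed

text \<open>Double counting of the paths \<open>x\<close>, \<open>z\<close>, \<open>y\<close> along
  \<open>a\<close> and \<open>a\<inverse>\<close> from a fixed source \<open>x\<close> of
  \<open>a\<close>: sorting by the class of \<open>(x, y)\<close> gives the left side, sorting by
  the middle point \<open>z\<close> the right side.\<close>

lemma sum_structure_constant_valency:
  assumes a: "a \<in> S"
  shows "(\<Sum>c\<in>S. structure_constant X a (a\<inverse>) c * valency X c) = valency X a * valency X (a\<inverse>)"
proof -
  note a' = cc_converse[OF a]
  obtain x y0 where xy0: "(x, y0) \<in> a"
    using cc_nonempty[OF a] by blast
  then have xX: "x \<in> X" using cc_subset[OF a] by auto
  let ?N = "\<lambda>y. card {z \<in> X. (x, z) \<in> a \<and> (z, y) \<in> a\<inverse>}"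
  have fin: "finite {y \<in> X. Q y}" for Q
    using cc_finite_points by simp
  have un: "(\<Union>c\<in>S. {y \<in> X. (x, y) \<in> c}) = X"
    using cc_cover[OF xX] by blast
  have "(\<Sum>c\<in>S. structure_constant X a (a\<inverse>) c * valency X c)
      = (\<Sum>c\<in>S. \<Sum>y\<in>{y \<in> X. (x, y) \<in> c}. ?N y)"
  proof (rule sum.cong[OF refl])
    fix c assume c: "c \<in> S"
    show "structure_constant X a (a\<inverse>) c * valency X c = (\<Sum>y\<in>{y \<in> X. (x, y) \<in> c}. ?N y)"
    proof (cases "x \<in> Domain c")
      case True
      then obtain w where xw: "(x, w) \<in> c" by blast
      have "(\<Sum>y\<in>{y \<in> X. (x, y) \<in> c}. ?N y)
          = (\<Sum>y\<in>{y \<in> X. (x, y) \<in> c}. structure_constant X a (a\<inverse>) c)"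
        using structure_constant_eq[OF cc a a' c] by (intro sum.cong refl) auto
      then show ?thesis
        using valency_eq[OF cc c xw] by simp
    next
      case False
      obtain u v where uv: "(u, v) \<in> c" using cc_nonempty[OF c] by blast
      \<comment> \<open>There are no \<open>c\<close>-edges at \<open>x\<close> to count, but
        \<open>valency X c\<close> is positive, so the structure constant has to vanish. An
        \<open>a\<close>-edge at \<open>u\<close> would make every source of \<open>a\<close>, in
        particular \<open>x\<close>, a source of \<open>c\<close>.\<close>
      have "u \<notin> Domain a"
        using Domain_subset_if_meet[OF c a, of u] uv xy0 False by blast
      then have "structure_constant X a (a\<inverse>) c = 0"
        using structure_constant_pos_iff[OF a a' c uv] by blast
      moreover have "{y \<in> X. (x, y) \<in> c} = {}" using False by blast
      ultimately show ?thesis by (simp only: sum.empty mult_0)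
    qed
  qed
  also have "\<dots> = sum ?N (\<Union>c\<in>S. {y \<in> X. (x, y) \<in> c})"
    using cc_finite fin partition_on_eqI[OF cc_partition]
    by (subst sum.UNION_disjoint) (simp_all, blast)
  also have "\<dots> = sum ?N X" unfolding un ..
  also have "\<dots> = (\<Sum>y\<in>X. \<Sum>z\<in>{z \<in> X. (x, z) \<in> a}. if (z, y) \<in> a\<inverse> then 1 else 0)"
    using fin by (intro sum.cong refl) (simp add: sum.If_cases Collect_conj_eq Int_ac)
  also have "\<dots> = (\<Sum>z\<in>{z \<in> X. (x, z) \<in> a}. \<Sum>y\<in>X. if (z, y) \<in> a\<inverse> then 1 else 0)"
    by (rule sum.swap)
  also have "\<dots> = (\<Sum>z\<in>{z \<in> X. (x, z) \<in> a}. valency X (a\<inverse>))"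
  proof (rule sum.cong[OF refl])
    fix z assume "z \<in> {z \<in> X. (x, z) \<in> a}"
    then have "(z, x) \<in> a\<inverse>" by simp
    from valency_eq[OF cc a' this]
    show "(\<Sum>y\<in>X. if (z, y) \<in> a\<inverse> then 1 else 0) = valency X (a\<inverse>)"
      using cc_finite_points by (simp add: sum.If_cases Collect_conj_eq)
  qed
  also have "\<dots> = valency X a * valency X (a\<inverse>)"
    using valency_eq[OF cc a xy0] by simp
  finally show ?thesis .
qed

text \<open>The weight \<open>sqrt (valency X c)\<close> completes the root in
  \<open>dagger_mult\<close> to the full valency of \<open>c\<close>, which reduces the sum to the
  preceding count.\<close>

lemma sum_dagger_mult_sqrt_valency:
  assumes a: "a \<in> S"
  shows "(\<Sum>c\<in>S. dagger_mult X a (a\<inverse>) c * sqrt (valency X c))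
       = sqrt (valency X a) * sqrt (valency X (a\<inverse>))"
proof -
  let ?v = "\<lambda>c. real (valency X c)"
  have "(\<Sum>c\<in>S. dagger_mult X a (a\<inverse>) c * sqrt (?v c))
      = (\<Sum>c\<in>S. real (structure_constant X a (a\<inverse>) c * valency X c)) / sqrt (?v a * ?v (a\<inverse>))"
    unfolding sum_divide_distrib dagger_mult_def
    by (intro sum.cong refl) (simp add: real_sqrt_divide)
  also have "\<dots> = real (valency X a * valency X (a\<inverse>)) / sqrt (?v a * ?v (a\<inverse>))"
    by (simp only: sum_structure_constant_valency[OF a] flip: of_nat_sum)
  also have "\<dots> = sqrt (?v a) * sqrt (?v (a\<inverse>))"
    by (simp add: real_div_sqrt real_sqrt_mult[symmetric])
  finally show ?thesis .
qed

text \<open>A closed path \<open>x\<close>, \<open>z\<close>, \<open>x\<close> puts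
  \<open>(z, x)\<close> into both \<open>b\<close> and \<open>a\<inverse>\<close>, which are blocks
  of one partition. The closed paths at \<open>x\<close> then correspond to the
  \<open>a\<close>-edges at \<open>x\<close>, and \<open>d\<close> has valency 1.\<close>

lemma dagger_mult_diagonal_imp_converse:
  assumes a: "a \<in> S" and b: "b \<in> S" and d: "d \<in> S" "d \<subseteq> Id_on X"
    and nz: "dagger_mult X a b d \<noteq> 0"
  shows "b = a\<inverse>" and "dagger_mult X a b d = sqrt (valency X a) / sqrt (valency X b)"
proof -
  obtain x where x: "(x, x) \<in> d" using cc_nonempty[OF d(1)] d(2) by auto
  have "structure_constant X a b d > 0" using nz unfolding dagger_mult_def by auto
  then obtain z where z: "(x, z) \<in> a" "(z, x) \<in> b"
    using structure_constant_pos_iff[OF a b d(1) x] by blast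
  show "b = a\<inverse>"
    using partition_on_eqI[OF cc_partition b cc_converse[OF a] z(2)] z(1) by blast
  then have "structure_constant X a b d = valency X a"
    using structure_constant_eq[OF cc a b d(1) x] valency_eq[OF cc a z(1)] by simp
  moreover have "{y \<in> X. (x, y) \<in> d} = {x}"
    using x d(2) cc_subset[OF d(1)] by auto
  then have "valency X d = 1" using valency_eq[OF cc d(1) x] by simp
  ultimately show "dagger_mult X a b d = sqrt (valency X a) / sqrt (valency X b)"
    unfolding dagger_mult_def
    by (simp add: real_sqrt_divide real_sqrt_mult real_div_sqrt flip: divide_divide_eq_left)
qed

text \<open>The witness is the class of \<open>(x, x)\<close> for any source \<open>x\<close> of
  \<open>a\<close>: going along an \<open>a\<close>-edge and back is a closed path.\<close>

lemma ex_diagonal_dagger_mult: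
  assumes a: "a \<in> S"
  shows "\<exists>d\<in>S. d \<subseteq> Id_on X \<and> dagger_mult X a (a\<inverse>) d \<noteq> 0"
proof -
  note a' = cc_converse[OF a]
  obtain x y where xy: "(x, y) \<in> a" using cc_nonempty[OF a] by blast
  obtain d where d: "d \<in> S" "(x, x) \<in> d"
    using cc_cover xy cc_subset[OF a] by blast
  have "structure_constant X a (a\<inverse>) d > 0"
    using structure_constant_pos_iff[OF a a' d] xy by blast
  then have "dagger_mult X a (a\<inverse>) d \<noteq> 0"
    using valency_pos[OF a] valency_pos[OF a'] valency_pos[OF d(1)]
    unfolding dagger_mult_def by simp
  then show ?thesis using d cc_diagonal[OF d] by blast
qed

end

section \<open>Comparison of valencies across an isomorphism of dagger structures\<close>

lemma valency_le_of_dagger_iso: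
  fixes \<theta> :: "('a \<times> 'a) set \<Rightarrow> ('b \<times> 'b) set"
  assumes cc: "coherent_configuration X S" and cc': "coherent_configuration X' S'"
    and bij: "bij_betw \<theta> S S'"
    and mult: "\<And>a b c. a \<in> S \<Longrightarrow> b \<in> S \<Longrightarrow> c \<in> S \<Longrightarrow>
           dagger_mult X' (\<theta> a) (\<theta> b) (\<theta> c) = dagger_mult X a b c"
    and unit: "\<And>a. a \<in> S \<Longrightarrow> dagger_unit X' (\<theta> a) = dagger_unit X a"
    and s: "s \<in> S"
  shows "valency X' (\<theta> s) \<le> valency X s"
proof -
  define v where "v c = sqrt (valency X c)" for c
  define v' where "v' c = sqrt (valency X' (\<theta> c))" for c
  define r where "r c = v' c / v c" for c
  have img: "\<theta> c \<in> S'" if "c \<in> S" for c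
    using bij that by (auto dest: bij_betwE)
  have v: "v c > 0" "v' c > 0" if "c \<in> S" for c
    using valency_pos[OF cc that] valency_pos[OF cc' img[OF that]] by (simp_all add: v_def v'_def)
  have "\<exists>a\<in>S. r a = Max (r ` S)"
    using Max_in[of "r ` S"] cc_finite[OF cc] s by fastforce
  then obtain a where a: "a \<in> S" and "r a = Max (r ` S)" by blast
  then have max: "r c \<le> r a" if "c \<in> S" for c
    using that cc_finite[OF cc] by simp
  note a' = cc_converse[OF cc a]
  obtain d where d: "d \<in> S" "d \<subseteq> Id_on X" and nz: "dagger_mult X a (a\<inverse>) d \<noteq> 0"
    using ex_diagonal_dagger_mult[OF cc a] by blast
  \<comment> \<open>The unit enters here: it takes the value 1 exactly on diagonal classes, so
    \<open>\<theta>\<close> preserves them.\<close>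
  have d': "\<theta> d \<subseteq> Id_on X'"
    using d(2) unit[OF d(1)] by (simp add: dagger_unit_def split: if_splits)
  have nz': "dagger_mult X' (\<theta> a) (\<theta> (a\<inverse>)) (\<theta> d) \<noteq> 0"
    using nz mult a a' d by simp
  \<comment> \<open>\<open>conv(3)\<close> says that \<open>\<theta>\<close> commutes with the
    converse at \<open>a\<close>; \<open>conv(2)\<close> and \<open>conv(4)\<close> evaluate the two
    equal multiplication entries.\<close>
  note conv = dagger_mult_diagonal_imp_converse[OF cc a a' d nz]
    dagger_mult_diagonal_imp_converse[OF cc' img[OF a] img[OF a'] img[OF d(1)] d' nz']
  have "v' a / v' (a\<inverse>) = v a / v (a\<inverse>)"
    using conv(2,4) mult[OF a a' d(1)] by (simp add: v_def v'_def)
  then have r_conv: "r (a\<inverse>) = r a"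
    using v[OF a] v[OF a'] by (simp add: r_def field_simps)
  \<comment> \<open>One of the two factors \<open>r a\<close> is read as
    \<open>r (a\<inverse>)\<close>.\<close>
  have "r a * r a * (v a * v (a\<inverse>)) = v' a * v' (a\<inverse>)"
    using v[OF a] v[OF a'] by (subst (2) r_conv[symmetric]) (simp add: r_def)
  also have "\<dots> = (\<Sum>c\<in>S'. dagger_mult X' (\<theta> a) (\<theta> (a\<inverse>)) c * sqrt (valency X' c))"
    using sum_dagger_mult_sqrt_valency[OF cc' img[OF a]] conv(3) by (simp add: v'_def)
  also have "\<dots> = (\<Sum>c\<in>S. dagger_mult X a (a\<inverse>) c * v' c)"
    using mult a a' by (simp add: v'_def flip: sum.reindex_bij_betw[OF bij])
  \<comment> \<open>Maximality of \<open>r a\<close> gives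
    \<open>v' c = r c * v c \<le> r a * v c\<close>, and the coefficients are nonnegative.\<close>
  also have "\<dots> \<le> (\<Sum>c\<in>S. dagger_mult X a (a\<inverse>) c * (r a * v c))"
    using max v dagger_mult_nonneg
    by (intro sum_mono mult_left_mono) (simp_all add: r_def pos_divide_le_eq)
  also have "\<dots> = r a * (v a * v (a\<inverse>))"
    using sum_dagger_mult_sqrt_valency[OF cc a]
    by (simp add: v_def mult.left_commute flip: sum_distrib_left)
  finally have "r a * r a * (v a * v (a\<inverse>)) \<le> r a * (v a * v (a\<inverse>))" .
  moreover have "r a > 0" "v a * v (a\<inverse>) > 0"
    using v[OF a] v[OF a'] by (simp_all add: r_def)
  ultimately have "r a \<le> 1" by (simp add: mult_le_cancel_right)
  then have "r s \<le> 1" using max[OF s] by linarith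
  then show ?thesis
    using v[OF s] by (simp add: r_def v_def v'_def)
qed

theorem theorem8p3:
  fixes X :: "'a set" and S :: "('a \<times> 'a) set set"
    and X' :: "'b set" and S' :: "('b \<times> 'b) set set"
    and \<theta> :: "('a \<times> 'a) set \<Rightarrow> ('b \<times> 'b) set"
  assumes "coherent_configuration X S"
    and "coherent_configuration X' S'"
    and "bij_betw \<theta> S S'"
    and "\<And>a b c. a \<in> S \<Longrightarrow> b \<in> S \<Longrightarrow> c \<in> S \<Longrightarrow>
           dagger_mult X' (\<theta> a) (\<theta> b) (\<theta> c) = dagger_mult X a b c"
    and "\<And>a. a \<in> S \<Longrightarrow> dagger_unit X' (\<theta> a) = dagger_unit X a"
  shows "\<forall>a\<in>S. \<forall>b\<in>S. \<forall>c\<in>S.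
           structure_constant X' (\<theta> a) (\<theta> b) (\<theta> c) = structure_constant X a b c"
proof -
  define \<eta> where "\<eta> = inv_into S \<theta>"
  have \<eta>: "\<eta> c \<in> S" "\<theta> (\<eta> c) = c" if "c \<in> S'" for c
    using that assms(3) unfolding \<eta>_def bij_betw_def by (auto intro: inv_into_into f_inv_into_f)
  have \<eta>_\<theta>: "\<eta> (\<theta> a) = a" "\<theta> a \<in> S'" if "a \<in> S" for a
    using that assms(3) unfolding \<eta>_def bij_betw_def by auto
  have "bij_betw \<eta> S' S"
    using bij_betw_inv_into[OF assms(3)] by (simp add: \<eta>_def)
  moreover have "dagger_mult X (\<eta> a) (\<eta> b) (\<eta> c) = dagger_mult X' a b c"
    if "a \<in> S'" "b \<in> S'" "c \<in> S'" for a b c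
    using assms(4)[of "\<eta> a" "\<eta> b" "\<eta> c"] \<eta> that by simp
  moreover have "dagger_unit X (\<eta> a) = dagger_unit X' a" if "a \<in> S'" for a
    using assms(5)[of "\<eta> a"] \<eta> that by simp
  \<comment> \<open>The hypotheses are symmetric, so the bound also holds with the two
    configurations exchanged.\<close>
  ultimately have "valency X (\<eta> c) \<le> valency X' c" if "c \<in> S'" for c
    using valency_le_of_dagger_iso[OF assms(2,1)] that by blast
  then have val: "valency X' (\<theta> a) = valency X a" if "a \<in> S" for a
    using valency_le_of_dagger_iso[OF assms that] \<eta>_\<theta>[OF that] by (metis antisym)
  show ?thesis
  proof (intro ballI)
    fix a b c assume abc: "a \<in> S" "b \<in> S" "c \<in> S"
    show "structure_constant X' (\<theta> a) (\<theta> b) (\<theta> c) = structure_constant X a b c"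
      \<comment> \<open>With equal valencies both sides carry the same positive normalising factor,
        which cancels.\<close>
      using assms(4)[OF abc] abc[THEN valency_pos[OF assms(1)]]
      unfolding dagger_mult_def by (simp add: val abc)
  qed
qed

end
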